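(* Let $Q$ be a connected quandle with $n$ elements. If the profile of $Q$ is $\{1,n-1\}$, then $Q$ is latin.
   Context: A quandle is a set $Q$ with a binary operation $*$ such that: (1) $a*a=a$ for all $a\in Q$; (2) for all $a,b\in Q$ there is a unique $c\in Q$ with $a=c*b$; (3) $(a*b)*c=(a*c)*(b*c)$ for all $a,b,c\in Q$. For $b\in Q$ let $r_b:Q\to Q$, $r_b(x)=x*b$ (a bijection), and write $a\,\bar{*}\,b=r_b^{-1}(a)$. $Q$ is connected if for every $a\in Q$ the orbit $\{(\cdots((a\star_1 b_1)\star_2 b_2)\cdots\star_m b_m) : m\ge 0,\ b_i\in Q,\ \star_i\in\{*,\bar{*}\}\}$ equals $Q$. For a finite connected quandle $Q$, all the permutations $r_q$ ($q\in Q$) are conjugate in the symmetric group on $Q$; the profile of $Q$ is the multiset of lengths of the cycles in the disjoint cycle decomposition of $r_q$ for any (equivalently, every) $q\in Q$, with cycles of length $1$ (fixed points) included. Thus profile $\{1,n-1\}$ means that each $r_q$ is a product of a fixed point and a disjoint cycle of length $n-1$. A finite quandle $Q$ is latin if for every $i\in Q$ the map $l_i:Q\to Q$, $l_i(x)=i*x$, is a bijection. *)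

theory Defs
  imports "HOL-Library.Multiset" "HOL-Combinatorics.Orbits"
begin

locale quandle =
  fixes Q :: "'a set" and qop :: "'a \<Rightarrow> 'a \<Rightarrow> 'a" (infixl "\<star>" 70)
  assumes closed: "a \<in> Q \<Longrightarrow> b \<in> Q \<Longrightarrow> a \<star> b \<in> Q"
    and idem: "a \<in> Q \<Longrightarrow> a \<star> a = a"
    and right_div: "a \<in> Q \<Longrightarrow> b \<in> Q \<Longrightarrow> \<exists>!c. c \<in> Q \<and> a = c \<star> b"
    and right_distrib: "a \<in> Q \<Longrightarrow> b \<in> Q \<Longrightarrow> c \<in> Q \<Longrightarrow> (a \<star> b) \<star> c = (a \<star> c) \<star> (b \<star> c)"

definition right_mult :: "('a \<Rightarrow> 'a \<Rightarrow> 'a) \<Rightarrow> 'a \<Rightarrow> 'a \<Rightarrow> 'a" where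
  "right_mult qop b = (\<lambda>x. qop x b)"

definition left_mult :: "('a \<Rightarrow> 'a \<Rightarrow> 'a) \<Rightarrow> 'a \<Rightarrow> 'a \<Rightarrow> 'a" where
  "left_mult qop a = (\<lambda>x. qop a x)"

definition qbar :: "'a set \<Rightarrow> ('a \<Rightarrow> 'a \<Rightarrow> 'a) \<Rightarrow> 'a \<Rightarrow> 'a \<Rightarrow> 'a" where
  "qbar Q qop a b = inv_into Q (right_mult qop b) a"

inductive_set quandle_orbit :: "'a set \<Rightarrow> ('a \<Rightarrow> 'a \<Rightarrow> 'a) \<Rightarrow> 'a \<Rightarrow> 'a set"
  for Q :: "'a set" and qop :: "'a \<Rightarrow> 'a \<Rightarrow> 'a" and a :: 'a where
  base: "a \<in> quandle_orbit Q qop a"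
| mult: "x \<in> quandle_orbit Q qop a \<Longrightarrow> b \<in> Q \<Longrightarrow> qop x b \<in> quandle_orbit Q qop a"
| bar: "x \<in> quandle_orbit Q qop a \<Longrightarrow> b \<in> Q \<Longrightarrow> qbar Q qop x b \<in> quandle_orbit Q qop a"

locale connected_quandle = quandle +
  assumes connected: "a \<in> Q \<Longrightarrow> quandle_orbit Q qop a = Q"

locale latin_quandle = quandle +
  assumes finite_carrier: "finite Q"
    and left_bij: "i \<in> Q \<Longrightarrow> bij_betw (left_mult qop i) Q Q"

(* Intended for a finite set Q that f permutes: the set of orbits contains each cycle exactly
   once, and a fixed point x contributes the orbit {x}, i.e. a cycle of length 1. *)
definition cycle_lengths :: "('a \<Rightarrow> 'a) \<Rightarrow> 'a set \<Rightarrow> nat multiset" where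
  "cycle_lengths f Q = image_mset card (mset_set (orbit f ` Q))"

(* The choice of q does not matter for a connected quandle, see profile_eq below. *)
definition profile :: "'a set \<Rightarrow> ('a \<Rightarrow> 'a \<Rightarrow> 'a) \<Rightarrow> nat multiset" where
  "profile Q qop = cycle_lengths (right_mult qop (SOME q. q \<in> Q)) Q"

lemma orbit_image_conj:
  assumes closed: "\<And>x. x \<in> A \<Longrightarrow> f x \<in> A" and conj: "\<And>x. x \<in> A \<Longrightarrow> h (f x) = g (h x)"
    and x: "x \<in> A"
  shows "orbit g (h x) = h ` orbit f x"
proof -
  have *: "(f ^^ n) x \<in> A \<and> (g ^^ n) (h x) = h ((f ^^ n) x)" for n
    by (induction n) (use assms in auto)
  then show ?thesis
    by (auto simp: orbit_altdef)
qed

lemma cycle_lengths_conj: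
  assumes h: "bij_betw h A B" and closed: "\<And>x. x \<in> A \<Longrightarrow> f x \<in> A"
    and conj: "\<And>x. x \<in> A \<Longrightarrow> h (f x) = g (h x)"
  shows "cycle_lengths g B = cycle_lengths f A"
proof -
  have sub: "orbit f x \<subseteq> A" if "x \<in> A" for x
  proof
    fix y assume "y \<in> orbit f x"
    then show "y \<in> A" by induction (use closed that in auto)
  qed
  have "orbit g ` B = (\<lambda>x. orbit g (h x)) ` A"
    using h by (auto simp: bij_betw_def)
  also have "\<dots> = (`) h ` orbit f ` A"
    using orbit_image_conj[of A f h g] closed conj by (auto simp: image_image)
  finally have eq: "orbit g ` B = (`) h ` orbit f ` A" .
  have h_inj: "inj_on h A" using h by (simp add: bij_betw_def)
  have inj: "inj_on ((`) h) (orbit f ` A)"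
  proof (rule inj_onI)
    fix C D assume CD: "C \<in> orbit f ` A" "D \<in> orbit f ` A" and "h ` C = h ` D"
    have "C \<subseteq> A" "D \<subseteq> A" using CD sub by auto
    with \<open>h ` C = h ` D\<close> show "C = D" using inj_on_image_eq_iff[OF h_inj] by simp
  qed
  have "image_mset card (mset_set ((`) h ` orbit f ` A))
      = image_mset (\<lambda>C. card (h ` C)) (mset_set (orbit f ` A))"
    by (simp add: image_mset_mset_set[OF inj, symmetric] image_mset.compositionality o_def)
  also have "\<dots> = image_mset card (mset_set (orbit f ` A))"
  proof (cases "finite (orbit f ` A)")
    case True
    then show ?thesis
    proof (intro image_mset_cong card_image)
      fix C assume "C \<in># mset_set (orbit f ` A)"
      then have "C \<subseteq> A" using True sub by auto
      then show "inj_on h C" by (rule inj_on_subset[OF h_inj])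
    qed
  qed simp
  finally show ?thesis by (simp add: cycle_lengths_def eq)
qed

lemma (in quandle) right_mult_bij:
  assumes "b \<in> Q" shows "bij_betw (right_mult (\<star>) b) Q Q"
proof (rule bij_betwI')
  fix x y assume "x \<in> Q" "y \<in> Q"
  then show "right_mult (\<star>) b x = right_mult (\<star>) b y \<longleftrightarrow> x = y"
    using right_div[OF closed[OF \<open>x \<in> Q\<close> assms] assms] by (auto simp: right_mult_def)
next
  fix x assume "x \<in> Q"
  then show "right_mult (\<star>) b x \<in> Q" using closed assms by (simp add: right_mult_def)
next
  fix y assume "y \<in> Q"
  then show "\<exists>x\<in>Q. y = right_mult (\<star>) b x"
    using right_div[OF _ assms] unfolding right_mult_def by blast
qed

lemma (in quandle) cycle_lengths_right_mult:
  assumes "a \<in> Q" "b \<in> Q"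
  shows "cycle_lengths (right_mult (\<star>) (a \<star> b)) Q = cycle_lengths (right_mult (\<star>) a) Q"
proof (rule cycle_lengths_conj[OF right_mult_bij[OF assms(2)]])
  fix x assume "x \<in> Q"
  then show "right_mult (\<star>) a x \<in> Q"
    using closed assms(1) by (simp add: right_mult_def)
  show "right_mult (\<star>) b (right_mult (\<star>) a x) = right_mult (\<star>) (a \<star> b) (right_mult (\<star>) b x)"
    unfolding right_mult_def by (rule right_distrib[OF \<open>x \<in> Q\<close> assms])
qed

lemma (in connected_quandle) profile_eq:
  assumes "q \<in> Q"
  shows "profile Q (\<star>) = cycle_lengths (right_mult (\<star>) q) Q"
proof -
  define p where "p = (SOME q. q \<in> Q)"
  have p: "p \<in> Q" unfolding p_def using assms by (rule someI)
  have "q \<in> quandle_orbit Q (\<star>) p" using assms connected[OF p] by simp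
  then have "q \<in> Q \<and> cycle_lengths (right_mult (\<star>) q) Q = cycle_lengths (right_mult (\<star>) p) Q"
  proof induction
    case base
    show ?case using p by simp
  next
    case (mult x b)
    then show ?case using closed cycle_lengths_right_mult by simp
  next
    case (bar x b)
    have "qbar Q (\<star>) x b \<in> Q" and "qbar Q (\<star>) x b \<star> b = x"
      using bar right_mult_bij[of b] inv_into_into[of x "right_mult (\<star>) b" Q]
        f_inv_into_f[of x "right_mult (\<star>) b" Q]
      by (auto simp: qbar_def bij_betw_def right_mult_def)
    then show ?case using bar cycle_lengths_right_mult[of "qbar Q (\<star>) x b" b] by simp
  qed
  then show ?thesis by (simp add: profile_def p_def)
qed

end

theory Submission
  imports Defs
begin

text \<open>
  The orbits of \<open>r\<^sub>i\<close> are \<open>{i}\<close> and \<open>Q - {i}\<close>. Suppose that \<open>i \<star> x = i \<star> y = c\<close> with \<open>x\<close> and \<open>y\<close>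
  different from \<open>i\<close>, and write \<open>y\<close> as the image of \<open>x\<close> under a power \<open>g\<close> of \<open>r\<^sub>i\<close>. As \<open>g\<close> is an
  endomorphism that fixes \<open>i\<close>, it fixes \<open>c\<close>. By connectedness \<open>r\<^sub>x\<close> fixes only \<open>x\<close> (also when \<open>n = 2\<close>),
  hence \<open>c \<noteq> i\<close>, the element \<open>x\<close> lies in the
  \<open>r\<^sub>i\<close>-orbit of \<open>c\<close>, so \<open>g\<close> fixes \<open>x\<close> too, that is, \<open>y = x\<close>.
\<close>

lemma size_cycle_lengths: "size (cycle_lengths f Q) = card (orbit f ` Q)"
  by (simp add: cycle_lengths_def)

lemma funpow_commuting_fixpoint:
  assumes "(f ^^ k) c = c" and "x \<in> orbit f c"
  shows "(f ^^ k) x = x"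
proof -
  obtain m where m: "x = (f ^^ m) c" using assms(2) by (auto simp: orbit_altdef)
  have "(f ^^ k) ((f ^^ m) c) = (f ^^ m) ((f ^^ k) c)"
    by (metis add.commute comp_apply funpow_add)
  then show ?thesis by (simp add: m assms(1))
qed

lemma orbit_of_fixpoint:
  assumes "f x = x"
  shows "orbit f x = {x}"
proof -
  have "(f ^^ k) x = x" for k by (induction k) (simp_all add: assms)
  then show ?thesis by (auto simp: orbit_altdef)
qed

text \<open>By injectivity only \<open>q\<close> is mapped to \<open>q\<close>, so no other point
  has the orbit \<open>{q}\<close>; with two orbits in total, all other points share one.\<close>

lemma two_orbits_transitive:
  assumes f: "bij_betw f Q Q" and two: "card (orbit f ` Q) = 2"
    and q: "q \<in> Q" "f q = q" and x: "x \<in> Q" "x \<noteq> q" and y: "y \<in> Q" "y \<noteq> q"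
  shows "y \<in> orbit f x"
proof -
  have not_fix: "orbit f z \<noteq> orbit f q" if "z \<in> Q" "z \<noteq> q" for z
  proof
    assume "orbit f z = orbit f q"
    then have "f z = f q" using orbit.base[of f z] orbit_of_fixpoint[of f q] q by simp
    then show False using f that q by (auto simp: bij_betw_def inj_on_def)
  qed
  \<comment> \<open>\<open>orbit f x\<close> starts at \<open>f x\<close>, and \<open>Q\<close> may
    be infinite here, so \<open>y\<close> is placed in an orbit through its preimage
    \<open>z\<close>.\<close>
  obtain z where z: "z \<in> Q" "f z = y" using y(1) bij_betw_imp_surj_on[OF f] by (metis imageE)
  have "z \<noteq> q" using z y q by auto
  obtain A B where AB: "orbit f ` Q = {A, B}" using two by (auto simp: card_2_iff)
  have "orbit f x \<in> {A, B}" "orbit f z \<in> {A, B}" "orbit f q \<in> {A, B}"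
    using AB x z q by blast+
  then have "orbit f x = orbit f z"
    using not_fix[OF x] not_fix[OF z(1) \<open>z \<noteq> q\<close>] by auto
  then show ?thesis using orbit.base[of f z] z by simp
qed

lemma (in quandle) right_mult_funpow_closed:
  assumes "b \<in> Q" "x \<in> Q"
  shows "(right_mult (\<star>) b ^^ k) x \<in> Q"
  by (induction k) (use assms closed in \<open>auto simp: right_mult_def\<close>)

text \<open>Right distributivity makes each right multiplication an endomorphism, hence also its
  powers.\<close>

lemma (in quandle) right_mult_funpow_hom:
  assumes "b \<in> Q" "x \<in> Q" "y \<in> Q"
  shows "(right_mult (\<star>) b ^^ k) (x \<star> y) = (right_mult (\<star>) b ^^ k) x \<star> (right_mult (\<star>) b ^^ k) y"
proof (induction k)
  case (Suc k)
  show ?case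
    using Suc right_distrib[OF right_mult_funpow_closed[OF assms(1,2), of k]
        right_mult_funpow_closed[OF assms(1,3), of k] assms(1)]
    by (simp add: right_mult_def)
qed simp

lemma (in quandle) quandle_orbit_of_fixpoint:
  assumes a: "a \<in> Q" and fixed: "\<And>b. b \<in> Q \<Longrightarrow> a \<star> b = a"
  shows "quandle_orbit Q (\<star>) a = {a}"
proof -
  have "x = a" if "x \<in> quandle_orbit Q (\<star>) a" for x
    using that
  proof induction
    case (bar x b)
    have "inj_on (right_mult (\<star>) b) Q" using right_mult_bij[OF bar(2)] by (rule bij_betw_imp_inj_on)
    then have "inv_into Q (right_mult (\<star>) b) (right_mult (\<star>) b a) = a" using a by (rule inv_into_f_f)
    then show ?case using bar fixed by (simp add: qbar_def right_mult_def)
  qed (auto simp: fixed)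
  then show ?thesis using quandle_orbit.base[of a Q "(\<star>)"] by auto
qed

text \<open>If \<open>i\<close> differs from \<open>q\<close>, its orbit \<open>{i}\<close> must
  contain every element other than \<open>q\<close>, so \<open>Q = {i, q}\<close>. Then all right
  multiplications fix \<open>i\<close>, against connectedness.\<close>

lemma (in connected_quandle) fixpoint_unique:
  assumes trans: "\<And>x y. \<lbrakk>x \<in> Q; x \<noteq> q; y \<in> Q; y \<noteq> q\<rbrakk> \<Longrightarrow> y \<in> orbit (right_mult (\<star>) q) x"
    and i: "i \<in> Q" and q: "q \<in> Q" and fixed: "i \<star> q = i"
  shows "i = q"
proof (rule ccontr)
  assume "i \<noteq> q"
  have "orbit (right_mult (\<star>) q) i = {i}"
    using fixed by (intro orbit_of_fixpoint) (simp add: right_mult_def)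
  then have "y = i \<or> y = q" if "y \<in> Q" for y using trans[OF i \<open>i \<noteq> q\<close>] that by blast
  then have "quandle_orbit Q (\<star>) i = {i}"
    using quandle_orbit_of_fixpoint[OF i] fixed idem[OF i] by blast
  then show False using connected[OF i] q \<open>i \<noteq> q\<close> by auto
qed

lemma (in connected_quandle) left_mult_inj_on:
  assumes trans: "\<And>q x y. \<lbrakk>q \<in> Q; x \<in> Q; x \<noteq> q; y \<in> Q; y \<noteq> q\<rbrakk> \<Longrightarrow> y \<in> orbit (right_mult (\<star>) q) x"
    and i: "i \<in> Q"
  shows "inj_on (left_mult (\<star>) i) Q"
proof (rule inj_onI)
  fix x y assume x: "x \<in> Q" and y: "y \<in> Q" and "left_mult (\<star>) i x = left_mult (\<star>) i y"
  then have eq: "i \<star> x = i \<star> y" by (simp add: left_mult_def)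
  let ?r = "right_mult (\<star>) i"
  have fixD: "i = q" if "q \<in> Q" "i \<star> q = i" for q
    using fixpoint_unique[OF trans i] that by blast
  show "x = y"
  proof (cases "x = i \<or> y = i")
    \<comment> \<open>If \<open>x = i\<close>, then \<open>i \<star> y = i \<star> i = i\<close> and
      \<open>fixD\<close> gives \<open>y = i\<close>; likewise for \<open>y = i\<close>.\<close>
    case True
    then show ?thesis using fixD[OF x] fixD[OF y] eq idem[OF i] by auto
  next
    case False
    then obtain k where k: "y = (?r ^^ k) x"
      using trans[OF i x _ y] by (auto simp: orbit_altdef)
    have "(?r ^^ k) i = i" by (induction k) (simp_all add: right_mult_def idem[OF i])
    then have c: "(?r ^^ k) (i \<star> x) = i \<star> x"
      using right_mult_funpow_hom[OF i i x, of k] eq k by simp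
    have "x \<in> orbit ?r (i \<star> x)"
      using trans[OF i closed[OF i x] _ x] False fixD[OF x] by auto
    from funpow_commuting_fixpoint[OF c this] show ?thesis using k by simp
  qed
qed

theorem theorem1p9:
  fixes Q :: "'a set" and qop :: "'a \<Rightarrow> 'a \<Rightarrow> 'a" and n :: nat
  assumes "connected_quandle Q qop"
    and "finite Q" and "card Q = n"
    and "profile Q qop = {#1, n - 1#}"
  shows "latin_quandle Q qop"
proof -
  interpret connected_quandle Q qop by fact
  have trans: "y \<in> orbit (right_mult qop q) x"
    if q: "q \<in> Q" and "x \<in> Q" "x \<noteq> q" "y \<in> Q" "y \<noteq> q" for q x y
  proof (rule two_orbits_transitive[OF right_mult_bij[OF q] _ q _ that(2-)])
    \<comment> \<open>The size of the profile counts the orbits; \<open>{#1, n - 1#}\<close> has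
      size 2 also when both entries are 1.\<close>
    show "card (orbit (right_mult qop q) ` Q) = 2"
      using assms(4) profile_eq[OF q] size_cycle_lengths[of "right_mult qop q" Q] by simp
    show "right_mult qop q q = q" using idem[OF q] by (simp add: right_mult_def)
  qed
  show ?thesis
  proof unfold_locales
    fix i assume i: "i \<in> Q"
    have "left_mult qop i ` Q \<subseteq> Q" using closed[OF i] by (auto simp: left_mult_def)
    with left_mult_inj_on[OF trans i] show "bij_betw (left_mult qop i) Q Q"
      using endo_inj_surj[OF assms(2)] by (auto simp: bij_betw_def)
  qed fact
qed

end
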